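(* Let $j\ge 1$ and $p\geq 3$ be integers and let $G=(V,E)$ be a $K_{1,p}$-free graph with minimum degree $\delta(G)\geq j-1$. Then $$\alpha_j(G)\leq\frac{j(p-1)n(G)}{j(p-1)+\delta(G)-(j-1)}.$$
   Context: All graphs are simple and finite. $n(G)=|V|$. A graph is $K_{1,p}$-free if it has no induced subgraph isomorphic to $K_{1,p}$. A $j$-independent set is a set $I\subseteq V$ such that the subgraph induced by $I$ has maximum degree less than $j$; $\alpha_j(G)$ is the cardinality of a largest $j$-independent set. *)

theory Defs
  imports Complex_Main "Graph_Theory.Graph_Theory"
begin

text \<open>
  A finite simple undirected graph is a \<^locale>\<open>graph\<close>: a finite symmetric digraph without
  loops or parallel arcs. Each undirected edge is a pair of opposite arcs, so the degree of a
  vertex is its \<^const>\<open>out_degree\<close>.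
\<close>

text \<open>Unspecified for the graph without vertices.\<close>

definition min_degree :: "('a, 'b) pre_digraph \<Rightarrow> nat" where
  "min_degree G = Min (out_degree G ` verts G)"

text \<open>The graph without vertices has maximum degree 0, which makes the empty set
  \<open>j\<close>-independent for every \<open>j \<ge> 1\<close>; on all other graphs the inserted 0 has no effect.\<close>

definition max_degree :: "('a, 'b) pre_digraph \<Rightarrow> nat" where
  "max_degree G = Max (insert 0 (out_degree G ` verts G))"

text \<open>\<^term>\<open>complete_bipartite_digraph 1 p H\<close> says that \<open>H\<close> is isomorphic to the star with
  \<open>p\<close> leaves.\<close>

definition star_free :: "nat \<Rightarrow> ('a, 'b) pre_digraph \<Rightarrow> bool" where
  "star_free p G \<longleftrightarrow> \<not> (\<exists>H. induced_subgraph H G \<and> complete_bipartite_digraph 1 p H)"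

definition j_independent :: "nat \<Rightarrow> ('a, 'b) pre_digraph \<Rightarrow> 'a set \<Rightarrow> bool" where
  "j_independent j G I \<longleftrightarrow> I \<subseteq> verts G \<and> max_degree (G \<restriction> I) < j"

definition alpha :: "nat \<Rightarrow> ('a, 'b) pre_digraph \<Rightarrow> nat" where
  "alpha j G = Max (card ` {I. j_independent j G I})"

end

theory Submission
  imports Defs
begin

text \<open>
  Double-count the edges that leave a largest \<open>j\<close>-independent set \<open>I\<close>. Let \<open>\<delta>\<close> be the minimum
  degree and \<open>n\<close> the number of vertices. A vertex of \<open>I\<close> has at most \<open>j - 1\<close> of its at least \<open>\<delta>\<close>
  neighbours in \<open>I\<close>, so at least \<open>\<bar>I\<bar> * (\<delta> - (j - 1))\<close> edges leave \<open>I\<close>.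

  On the other hand, let \<open>u\<close> be a vertex outside \<open>I\<close>. Its neighbours in \<open>I\<close> again induce a
  subgraph of maximum degree less than \<open>j\<close>, so if there were more than \<open>j * (p - 1)\<close> of them, a
  greedy choice would find \<open>p\<close> pairwise nonadjacent ones
  (\<open>independent_subset_of_bounded_degree\<close>). Together with \<open>u\<close> these would induce a
  \<open>K\<^sub>1\<^sub>,\<^sub>p\<close> (\<open>star_of_independent_neighbours\<close>). Hence at most \<open>j * (p - 1) * (n - \<bar>I\<bar>)\<close> edges
  leave \<open>I\<close>, and comparing the two bounds gives the claim.
\<close>

text \<open>The greedy argument: choosing a vertex and discarding it together with its neighbours
  costs at most \<open>j\<close> vertices, so it can be repeated \<open>m\<close> times and still leave a vertex to choose.\<close>

lemma independent_subset_of_bounded_degree: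
  fixes E :: "'a rel"
  assumes "sym E" and "irrefl E"
    and "finite S" and "\<And>v. v \<in> S \<Longrightarrow> card {w \<in> S. (v, w) \<in> E} < j"
    and "j * m < card S"
  shows "\<exists>T \<subseteq> S. card T = Suc m \<and> (\<forall>x \<in> T. \<forall>y \<in> T. (x, y) \<notin> E)"
  using assms(3-)
proof (induction m arbitrary: S)
  case 0
  then obtain x where "x \<in> S" by fastforce
  with \<open>irrefl E\<close> show ?case
    by (intro exI[of _ "{x}"]) (auto simp: irrefl_def)
next
  case (Suc m)
  from Suc.prems(3) obtain x where x: "x \<in> S" by fastforce
  let ?N = "insert x {w \<in> S. (x, w) \<in> E}"
  let ?S = "S - ?N"
  have "card ?N \<le> j"
    using Suc.prems(1,2) x by (simp add: card_insert_if Suc_leI less_imp_le)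
  moreover have "card ?S = card S - card ?N"
    using Suc.prems(1) x by (intro card_Diff_subset) auto
  ultimately have large: "j * m < card ?S"
    using Suc.prems(3) by simp
  have deg: "card {w \<in> ?S. (v, w) \<in> E} < j" if "v \<in> ?S" for v
  proof -
    have "card {w \<in> ?S. (v, w) \<in> E} \<le> card {w \<in> S. (v, w) \<in> E}"
      using Suc.prems(1) by (intro card_mono) auto
    also have "\<dots> < j" using Suc.prems(2) that by simp
    finally show ?thesis .
  qed
  obtain T where T: "T \<subseteq> ?S" "card T = Suc m" "\<forall>a \<in> T. \<forall>b \<in> T. (a, b) \<notin> E"
    using Suc.IH[OF _ deg large] Suc.prems(1) by auto
  have "finite T" using T(2) by (metis card.infinite nat.simps(3))
  moreover have "x \<notin> T" using T(1) by auto
  ultimately have "card (insert x T) = Suc (Suc m)" using T(2) by simp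
  moreover have "\<forall>a \<in> insert x T. \<forall>b \<in> insert x T. (a, b) \<notin> E"
    using T(1,3) \<open>sym E\<close> \<open>irrefl E\<close> by (auto simp: irrefl_def dest: symD)
  ultimately show ?case
    using T(1) x by (intro exI[of _ "insert x T"]) auto
qed

text \<open>Without parallel arcs, an arc that leaves \<open>v\<close> is determined by its head.\<close>

lemma (in nomulti_digraph) out_degree_eq_card_neighbours:
  "out_degree G v = card {w. v \<rightarrow>\<^bsub>G\<^esub> w}"
proof -
  have "bij_betw (head G) (out_arcs G v) {w. v \<rightarrow>\<^bsub>G\<^esub> w}"
    unfolding bij_betw_def inj_on_def
    by (auto simp: arcs_ends_def arc_to_ends_def intro: no_multi_arcs)
  then show ?thesis unfolding out_degree_def by (rule bij_betw_same_card)
qed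

lemma dominates_induce_subgraph_iff:
  "u \<rightarrow>\<^bsub>G \<restriction> S\<^esub> v \<longleftrightarrow> u \<in> S \<and> v \<in> S \<and> u \<rightarrow>\<^bsub>G\<^esub> v"
  by (auto simp: arcs_ends_def arc_to_ends_def)

context graph
begin

lemma irrefl_arcs_ends: "irrefl (arcs_ends G)"
  by (auto simp: irrefl_def dest: adj_not_same)

lemma out_degree_induce_subgraph:
  assumes "S \<subseteq> verts G" and "v \<in> S"
  shows "out_degree (G \<restriction> S) v = card {w \<in> S. v \<rightarrow>\<^bsub>G\<^esub> w}"
proof -
  interpret S: digraph "G \<restriction> S"
    using assms(1) by (intro digraphI_induced induced_induce)
  show ?thesis
    using assms(2)
    by (simp add: S.out_degree_eq_card_neighbours dominates_induce_subgraph_iff)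
qed

lemma star_of_independent_neighbours:
  assumes "card T = p"
    and "\<And>t. t \<in> T \<Longrightarrow> u \<rightarrow>\<^bsub>G\<^esub> t" and "u \<in> verts G"
    and "\<And>x y. x \<in> T \<Longrightarrow> y \<in> T \<Longrightarrow> \<not> x \<rightarrow>\<^bsub>G\<^esub> y"
  shows "\<not> star_free p G"
proof -
  let ?H = "G \<restriction> (insert u T)"
  have "insert u T \<subseteq> verts G" using assms(2,3) adj_in_verts(2) by auto
  then have H: "induced_subgraph ?H G" by (rule induced_induce)
  have "graph ?H"
    using digraphI_induced[OF H] induced_graph_imp_symmetric[OF sym_arcs H]
    by (rule digraph.graphI)
  moreover have "u \<notin> T" using assms(2) adj_not_same by auto
  moreover have "arcs_ends ?H = {u} \<times> T \<union> T \<times> {u}"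
  proof (intro set_eqI iffI)
    fix e assume "e \<in> arcs_ends ?H"
    then show "e \<in> {u} \<times> T \<union> T \<times> {u}"
      using assms(4) adj_not_same
      by (cases e) (auto simp: dominates_induce_subgraph_iff)
  next
    fix e assume "e \<in> {u} \<times> T \<union> T \<times> {u}"
    then show "e \<in> arcs_ends ?H"
      using assms(2) by (cases e) (auto simp: dominates_induce_subgraph_iff intro: graph_symmetric)
  qed
  moreover have "verts ?H = {u} \<union> T" and "card {u} = 1" by simp_all
  ultimately have "complete_bipartite_digraph 1 p ?H"
    unfolding complete_bipartite_digraph_def using assms(1) by blast
  with H show ?thesis unfolding star_free_def by blast
qed

lemma j_independent_iff:
  assumes "j \<ge> 1"
  shows "j_independent j G I \<longleftrightarrow> I \<subseteq> verts G \<and> (\<forall>v \<in> I. card {w \<in> I. v \<rightarrow>\<^bsub>G\<^esub> w} < j)"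
proof (cases "I \<subseteq> verts G")
  case True
  then have "finite I" using finite_verts finite_subset by blast
  then show ?thesis
    using True assms
    by (auto simp: j_independent_def max_degree_def out_degree_induce_subgraph)
qed (simp add: j_independent_def)

lemma obtain_largest_j_independent:
  assumes "j \<ge> 1"
  obtains I where "j_independent j G I" and "card I = alpha j G"
proof -
  have "finite {I. j_independent j G I}"
    by (rule finite_subset[of _ "Pow (verts G)"]) (auto simp: j_independent_def)
  moreover have "j_independent j G {}"
    using assms by (simp add: j_independent_iff)
  ultimately have "alpha j G \<in> card ` {I. j_independent j G I}"
    unfolding alpha_def by (intro Max_in) auto
  then show ?thesis using that by auto
qed

lemma min_degree_le_card_neighbours:
  assumes "v \<in> verts G"
  shows "min_degree G \<le> card {w. v \<rightarrow>\<^bsub>G\<^esub> w}"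
  unfolding min_degree_def out_degree_eq_card_neighbours[symmetric]
  using assms by (intro Min_le) auto

text \<open>If \<open>min_degree G < j - 1\<close>, then the truncated subtraction makes the bound trivial.\<close>

lemma card_neighbours_outside_ge:
  assumes "j \<ge> 1" and "j_independent j G I" and "v \<in> I"
  shows "min_degree G - (j - 1) \<le> card {w \<in> verts G - I. v \<rightarrow>\<^bsub>G\<^esub> w}"
proof -
  have sub: "I \<subseteq> verts G" and inside: "card {w \<in> I. v \<rightarrow>\<^bsub>G\<^esub> w} < j"
    using assms by (auto simp: j_independent_iff)
  have "{w. v \<rightarrow>\<^bsub>G\<^esub> w} = {w \<in> I. v \<rightarrow>\<^bsub>G\<^esub> w} \<union> {w \<in> verts G - I. v \<rightarrow>\<^bsub>G\<^esub> w}"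
    using sub adj_in_verts(2) by auto
  then have "card {w. v \<rightarrow>\<^bsub>G\<^esub> w} \<le> card {w \<in> I. v \<rightarrow>\<^bsub>G\<^esub> w} + card {w \<in> verts G - I. v \<rightarrow>\<^bsub>G\<^esub> w}"
    by (simp only: card_Un_le)
  moreover have "min_degree G \<le> card {w. v \<rightarrow>\<^bsub>G\<^esub> w}"
    using sub assms(3) by (intro min_degree_le_card_neighbours) auto
  ultimately show ?thesis using inside by linarith
qed

text \<open>More neighbours in \<open>I\<close> would contain \<open>p\<close> pairwise nonadjacent ones, the leaves of an
  induced star centred at \<open>u\<close>.\<close>

lemma card_neighbours_inside_le:
  assumes "j \<ge> 1" and "p \<ge> 1" and "star_free p G" and "j_independent j G I" and "u \<in> verts G"
  shows "card {v \<in> I. v \<rightarrow>\<^bsub>G\<^esub> u} \<le> j * (p - 1)"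
proof (rule ccontr)
  let ?S = "{v \<in> I. v \<rightarrow>\<^bsub>G\<^esub> u}"
  assume "\<not> card ?S \<le> j * (p - 1)"
  then have large: "j * (p - 1) < card ?S" by simp
  have sub: "I \<subseteq> verts G" and I: "\<And>v. v \<in> I \<Longrightarrow> card {w \<in> I. v \<rightarrow>\<^bsub>G\<^esub> w} < j"
    using assms by (auto simp: j_independent_iff)
  have fin: "finite I" using sub finite_verts finite_subset by blast
  have deg: "card {w \<in> ?S. v \<rightarrow>\<^bsub>G\<^esub> w} < j" if "v \<in> ?S" for v
  proof -
    have "card {w \<in> ?S. v \<rightarrow>\<^bsub>G\<^esub> w} \<le> card {w \<in> I. v \<rightarrow>\<^bsub>G\<^esub> w}"
      using fin by (intro card_mono) auto
    also have "\<dots> < j" using I that by simp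
    finally show ?thesis .
  qed
  have "sym (arcs_ends G)" using sym_arcs by (simp add: symmetric_def)
  then obtain T where "T \<subseteq> ?S" "card T = Suc (p - 1)" "\<forall>x \<in> T. \<forall>y \<in> T. \<not> x \<rightarrow>\<^bsub>G\<^esub> y"
    using independent_subset_of_bounded_degree[OF _ irrefl_arcs_ends _ deg large] fin by auto
  moreover from \<open>T \<subseteq> ?S\<close> have "u \<rightarrow>\<^bsub>G\<^esub> t" if "t \<in> T" for t
    using that by (blast intro: graph_symmetric)
  ultimately have "\<not> star_free p G"
    using assms(2,5) by (intro star_of_independent_neighbours[of T p u]) auto
  with assms(3) show False by simp
qed

lemma j_independent_double_count:
  assumes "j \<ge> 1" and "p \<ge> 1" and "star_free p G" and "j_independent j G I"
  shows "card I * (min_degree G - (j - 1)) \<le> j * (p - 1) * (card (verts G) - card I)"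
proof -
  have sub: "I \<subseteq> verts G" using assms(4) by (simp add: j_independent_def)
  then have fin: "finite I" using finite_verts finite_subset by blast
  have "card I * (min_degree G - (j - 1)) \<le> (\<Sum>v\<in>I. card {u \<in> verts G - I. v \<rightarrow>\<^bsub>G\<^esub> u})"
    using sum_bounded_below[OF card_neighbours_outside_ge[OF assms(1,4)]] by simp
  also have "\<dots> = (\<Sum>u\<in>verts G - I. card {v \<in> I. v \<rightarrow>\<^bsub>G\<^esub> u})"
    using fin by (intro sum_multicount_gen) auto
  also have "\<dots> \<le> card (verts G - I) * (j * (p - 1))"
    using sum_bounded_above[of "verts G - I", OF card_neighbours_inside_le[OF assms]] by simp
  also have "\<dots> = j * (p - 1) * (card (verts G) - card I)"
    using sub fin by (simp add: card_Diff_subset)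
  finally show ?thesis .
qed

end

theorem theorem4p12:
  fixes G :: "('a, 'b) pre_digraph" and j p :: nat
  assumes "graph G"
    and "j \<ge> 1" and "p \<ge> 3"
    and "star_free p G"
    and "min_degree G \<ge> j - 1"
  shows "real (alpha j G) \<le>
    real j * (real p - 1) * real (card (verts G)) /
      (real j * (real p - 1) + real (min_degree G) - (real j - 1))"
proof -
  interpret graph G by fact
  obtain I where I: "j_independent j G I" "card I = alpha j G"
    using obtain_largest_j_independent[OF assms(2)] .
  have le: "card I \<le> card (verts G)"
    using I(1) by (intro card_mono) (auto simp: j_independent_def)
  define a where "a = real j * (real p - 1)"
  define d where "d = real (min_degree G) - (real j - 1)"
  have "d \<ge> 0" using assms(2,5) by (simp add: d_def)
  moreover have "a > 0" using assms(2,3) by (simp add: a_def)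
  ultimately have pos: "a + d > 0" by simp
  have "real (card I) * d = real (card I * (min_degree G - (j - 1)))"
    using assms(2,5) by (simp add: d_def)
  also have "\<dots> \<le> real (j * (p - 1) * (card (verts G) - card I))"
    using j_independent_double_count[OF assms(2) _ assms(4) I(1)] assms(3)
    by (intro of_nat_mono) simp
  also have "\<dots> = a * (real (card (verts G)) - real (card I))"
    using assms(3) le by (simp add: a_def)
  finally have "real (card I) * (a + d) \<le> a * real (card (verts G))"
    by (simp add: algebra_simps)
  then have "real (card I) \<le> a * real (card (verts G)) / (a + d)"
    using pos by (simp add: pos_le_divide_eq)
  then show ?thesis
    using I(2) by (simp add: a_def d_def algebra_simps)
qed

end
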